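(* Suppose that $\mu$ is a determinantal probability measure on $2^{[n]}$ whose corresponding $n\times n$ matrix is a positive contraction. Then $\mu$ is strongly Rayleigh.
   Context: Notation: $[n]=\{1,\dots,n\}$. For a probability measure $\mu$ on $2^{[n]}$ the generating polynomial is $g_\mu(z_1,\dots,z_n)=\sum_{S\subseteq[n]}\mu(S)\prod_{i\in S}z_i$. A polynomial $f\in\mathbb{C}[z_1,\dots,z_n]$ is stable if $f(z_1,\dots,z_n)\ne0$ whenever $\mathrm{Im}(z_j)>0$ for all $j$. $\mu$ is strongly Rayleigh if $g_\mu$ is stable. A probability measure $\mu$ on $2^{[n]}$ is determinantal, with corresponding matrix $A$, if $A$ is an $n\times n$ (complex) matrix such that $\mu(\{T\subseteq[n]: S\subseteq T\})=\det(A[S])$ for every $S\subseteq[n]$, where $A[S]$ is the principal submatrix of $A$ with rows and columns indexed by $S$ and $\det(A[\emptyset])=1$. A positive contraction is a positive semi-definite Hermitian matrix all of whose eigenvalues lie in $[0,1]$. *)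

theory Defs
  imports
    "HOL-Probability.Probability_Mass_Function"
    "Jordan_Normal_Form.Schur_Decomposition"
    "Jordan_Normal_Form.DL_Submatrix"
begin

text \<open>
  The ground set of size \<open>n\<close> is \<open>{..<n}\<close>, so that it matches the 0-based indices of the matrix
  library. The variables \<open>z\<^sub>0, \<dots>, z\<^sub>n\<^sub>-\<^sub>1\<close> of a polynomial are given by a valuation
  \<open>nat \<Rightarrow> complex\<close>, of which only the values on \<open>{..<n}\<close> matter.
\<close>

definition prob_on_subsets :: "nat \<Rightarrow> nat set pmf \<Rightarrow> bool" where
  "prob_on_subsets n \<mu> \<longleftrightarrow> set_pmf \<mu> \<subseteq> Pow {..<n}"

definition gen_poly :: "nat \<Rightarrow> nat set pmf \<Rightarrow> (nat \<Rightarrow> complex) \<Rightarrow> complex" where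
  "gen_poly n \<mu> z = (\<Sum>S\<in>Pow {..<n}. complex_of_real (pmf \<mu> S) * (\<Prod>i\<in>S. z i))"

definition stable :: "nat \<Rightarrow> ((nat \<Rightarrow> complex) \<Rightarrow> complex) \<Rightarrow> bool" where
  "stable n f \<longleftrightarrow> (\<forall>z. (\<forall>j<n. Im (z j) > 0) \<longrightarrow> f z \<noteq> 0)"

definition strongly_Rayleigh :: "nat \<Rightarrow> nat set pmf \<Rightarrow> bool" where
  "strongly_Rayleigh n \<mu> \<longleftrightarrow> stable n (gen_poly n \<mu>)"

text \<open>For \<open>S = {}\<close> the submatrix is the \<open>0 \<times> 0\<close> matrix, whose determinant is \<open>1\<close>.\<close>

definition determinantal :: "nat \<Rightarrow> nat set pmf \<Rightarrow> complex mat \<Rightarrow> bool" where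
  "determinantal n \<mu> A \<longleftrightarrow> A \<in> carrier_mat n n \<and>
     (\<forall>S\<subseteq>{..<n}. complex_of_real (measure_pmf.prob \<mu> {T. T \<subseteq> {..<n} \<and> S \<subseteq> T})
        = Determinant.det (submatrix A S S))"

definition hermitian :: "complex mat \<Rightarrow> bool" where
  "hermitian A \<longleftrightarrow> mat_adjoint A = A"

text \<open>
  The comparison \<open>0 \<le> z\<close> on complex numbers means that \<open>z\<close> is real and nonnegative;
  \<open>(A *\<^sub>v v) \<bullet>c v\<close> is the form \<open>v\<^sup>* A v\<close>.
\<close>

definition positive_semidefinite :: "nat \<Rightarrow> complex mat \<Rightarrow> bool" where
  "positive_semidefinite n A \<longleftrightarrow> A \<in> carrier_mat n n \<and> hermitian A \<and>
     (\<forall>v\<in>carrier_vec n. 0 \<le> (A *\<^sub>v v) \<bullet>c v)"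

definition positive_contraction :: "nat \<Rightarrow> complex mat \<Rightarrow> bool" where
  "positive_contraction n A \<longleftrightarrow> positive_semidefinite n A \<and>
     (\<forall>k. eigenvalue A k \<longrightarrow> k \<in> complex_of_real ` {0..1})"

end

theory Submission
  imports Defs
begin

text \<open>
  By inclusion--exclusion, the generating polynomial at \<open>1 + w\<close> is the sum over \<open>S\<close> of
  \<open>det (A[S]) \<cdot> (\<Prod>i\<in>S. w\<^sub>i)\<close>, that is, \<open>det (I + W A)\<close> with \<open>W = diag w\<close>. If it vanishes, some \<open>v \<noteq> 0\<close>
  satisfies \<open>v = - W u\<close> with \<open>u = A v\<close>, whence \<open>u \<noteq> 0\<close>. Now \<open>v\<^sup>* A v\<close> is real and its conjugate is
  \<open>- \<Sum>i. w\<^sub>i |u\<^sub>i|\<^sup>2\<close>, whose imaginary part is negative when every \<open>Im w\<^sub>i\<close> is positive.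
\<close>

text \<open>\<open>pick S\<close> is strictly increasing, hence injective, and an injection into
  \<open>S\<close> from a set of \<open>card S\<close> positions is onto.\<close>

lemma bij_betw_pick:
  assumes "finite S"
  shows "bij_betw (pick S) {0..<card S} S"
proof -
  have "inj_on (pick S) {0..<card S}"
    by (rule linorder_inj_onI) (use pick_mono_le in force)+
  moreover have "pick S ` {0..<card S} \<subseteq> S"
    using pick_in_set_le by auto
  ultimately show ?thesis
    using assms by (simp add: bij_betw_def card_image card_subset_eq)
qed

text \<open>Conjugation by \<open>f\<close> matches the permutations of \<open>A\<close> with those
  of \<open>B\<close> and preserves the sign. This carries a Leibniz sum from one index set to
  another.\<close>

lemma sum_permutes_reindex:
  fixes g :: "'b \<Rightarrow> 'b \<Rightarrow> 'c :: comm_ring_1"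
  assumes f: "bij_betw f A B" and fin: "finite A"
  shows "(\<Sum>p | p permutes A. of_int (sign p) * (\<Prod>i\<in>A. g (f i) (f (p i))))
       = (\<Sum>q | q permutes B. of_int (sign q) * (\<Prod>i\<in>B. g i (q i)))"
proof (rule sum.reindex_bij_witness
    [where j = "map_permutation A f" and i = "map_permutation B (inv_into A f)"])
  have inj: "inj_on f A" using f by (rule bij_betw_imp_inj_on)
  fix p assume "p \<in> {p. p permutes A}"
  then have p: "p permutes A" by simp
  show "map_permutation B (inv_into A f) (map_permutation A f p) = p"
    by (rule map_permutation_compose_inv[OF f p]) (use inj in auto)
  show "map_permutation A f p \<in> {q. q permutes B}"
    using map_permutation_permutes[OF f p] by simp
  have "(\<Prod>i\<in>B. g i (map_permutation A f p i))
      = (\<Prod>i\<in>A. g (f i) (map_permutation A f p (f i)))"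
    by (rule prod.reindex_bij_betw[OF f, symmetric])
  also have "\<dots> = (\<Prod>i\<in>A. g (f i) (f (p i)))"
    by (intro prod.cong refl) (simp add: map_permutation_apply[OF inj])
  finally show "of_int (sign (map_permutation A f p)) * (\<Prod>i\<in>B. g i (map_permutation A f p i))
      = of_int (sign p) * (\<Prod>i\<in>A. g (f i) (f (p i)))"
    using sign_map_permutation[OF inj p fin] by simp
next
  have inv: "bij_betw (inv_into A f) B A" using f by (rule bij_betw_inv_into)
  fix q assume "q \<in> {q. q permutes B}"
  then have q: "q permutes B" by simp
  show "map_permutation A f (map_permutation B (inv_into A f) q) = q"
    by (rule map_permutation_compose_inv[OF inv q])
       (use f in \<open>auto simp: bij_betw_inv_into_right\<close>)
  show "map_permutation B (inv_into A f) q \<in> {p. p permutes A}"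
    using map_permutation_permutes[OF inv q] by simp
qed

text \<open>Rows and columns of a principal submatrix are numbered by the same bijection
  \<open>pick S\<close>, so relabelling positions by elements of \<open>S\<close> conjugates each
  permutation and keeps its sign.\<close>

lemma det_principal_submatrix:
  fixes A :: "'a :: comm_ring_1 mat"
  assumes A: "A \<in> carrier_mat n n" and S: "S \<subseteq> {..<n}"
  shows "Determinant.det (submatrix A S S)
       = (\<Sum>p | p permutes S. of_int (sign p) * (\<Prod>i\<in>S. A $$ (i, p i)))"
proof -
  have fin: "finite S" using S finite_subset by blast
  have eq: "{i. i < n \<and> i \<in> S} = S" using S by auto
  have sub: "submatrix A S S \<in> carrier_mat (card S) (card S)"
    using A by (auto simp: dim_submatrix eq)
  have "Determinant.det (submatrix A S S) = (\<Sum>p | p permutes {0..<card S}.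
      of_int (sign p) * (\<Prod>i = 0..<card S. A $$ (pick S i, pick S (p i))))"
    unfolding det_def'[OF sub]
  proof (intro sum.cong refl arg_cong2[where f = "(*)"] prod.cong)
    fix p i assume "p \<in> {p. p permutes {0..<card S}}" "i \<in> {0..<card S}"
    \<comment> \<open>Matrix entries are specified only within the dimensions, so the column index
      \<open>p i\<close> must be shown to be in range.\<close>
    moreover from this have "p i \<in> {0..<card S}" by (simp only: mem_Collect_eq permutes_in_image)
    ultimately show "submatrix A S S $$ (i, p i) = A $$ (pick S i, pick S (p i))"
      using A by (simp add: submatrix_index eq)
  qed
  also have "\<dots> = (\<Sum>p | p permutes S. of_int (sign p) * (\<Prod>i\<in>S. A $$ (i, p i)))"
    by (rule sum_permutes_reindex[OF bij_betw_pick[OF fin], where g = "\<lambda>i j. A $$ (i, j)"]) simp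
  finally show ?thesis .
qed

text \<open>In each Leibniz product, let \<open>S\<close> be the set of rows where the summand with
  \<open>w i\<close> is chosen. The other rows contribute Kronecker deltas, which leave only the
  permutations fixing everything outside \<open>S\<close>, and these form the Leibniz sum of the
  minor on \<open>S\<close>.\<close>

lemma det_one_plus_diag_mult:
  fixes A :: "'a :: comm_ring_1 mat"
  assumes A: "A \<in> carrier_mat n n"
  shows "Determinant.det (mat n n (\<lambda>(i, j). w i * A $$ (i, j) + (if i = j then 1 else 0)))
       = (\<Sum>S\<in>Pow {..<n}. (\<Prod>i\<in>S. w i) * Determinant.det (submatrix A S S))"
    (is "Determinant.det ?M = _")
proof -
  let ?d = "\<lambda>i j. if i = j then 1 else 0 :: 'a"
  have "Determinant.det ?M = (\<Sum>p | p permutes {..<n}.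
      of_int (sign p) * (\<Prod>i<n. w i * A $$ (i, p i) + ?d i (p i)))"
    unfolding det_def'[OF mat_carrier] atLeast0LessThan
  proof (intro sum.cong refl arg_cong2[where f = "(*)"] prod.cong)
    fix p i assume "p \<in> {p. p permutes {..<n}}" "i \<in> {..<n}"
    moreover from this have "p i \<in> {..<n}" by (simp only: mem_Collect_eq permutes_in_image)
    ultimately show "?M $$ (i, p i) = w i * A $$ (i, p i) + ?d i (p i)"
      by simp
  qed
  also have "\<dots> = (\<Sum>p | p permutes {..<n}. \<Sum>S\<in>Pow {..<n}. of_int (sign p) *
      ((\<Prod>i\<in>S. w i * A $$ (i, p i)) * (\<Prod>i\<in>{..<n} - S. ?d i (p i))))"
    by (simp add: prod_add sum_distrib_left)
  also have "\<dots> = (\<Sum>S\<in>Pow {..<n}. \<Sum>p | p permutes {..<n}. of_int (sign p) *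
      ((\<Prod>i\<in>S. w i * A $$ (i, p i)) * (\<Prod>i\<in>{..<n} - S. ?d i (p i))))"
    by (rule sum.swap)
  also have "\<dots> = (\<Sum>S\<in>Pow {..<n}. (\<Prod>i\<in>S. w i) * Determinant.det (submatrix A S S))"
  proof (intro sum.cong refl)
    fix S assume "S \<in> Pow {..<n}"
    then have S: "S \<subseteq> {..<n}" by simp
    have sub: "{p. p permutes S} \<subseteq> {p. p permutes {..<n}}"
      using S permutes_subset by blast
    have "(\<Sum>p | p permutes {..<n}. of_int (sign p) *
          ((\<Prod>i\<in>S. w i * A $$ (i, p i)) * (\<Prod>i\<in>{..<n} - S. ?d i (p i))))
        = (\<Sum>p | p permutes S. of_int (sign p) *
          ((\<Prod>i\<in>S. w i * A $$ (i, p i)) * (\<Prod>i\<in>{..<n} - S. ?d i (p i))))"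
    proof (rule sum.mono_neutral_right[OF _ sub])
      show "finite {p. p permutes {..<n}}" by (simp add: finite_permutations)
      show "\<forall>p\<in>{p. p permutes {..<n}} - {p. p permutes S}. of_int (sign p) *
          ((\<Prod>i\<in>S. w i * A $$ (i, p i)) * (\<Prod>i\<in>{..<n} - S. ?d i (p i))) = 0"
      proof
        fix p assume p: "p \<in> {p. p permutes {..<n}} - {p. p permutes S}"
        \<comment> \<open>A permutation of \<open>{..<n}\<close> that fixes every point outside
          \<open>S\<close> permutes \<open>S\<close>; hence this \<open>p\<close> moves some point
          outside \<open>S\<close>, and the delta there is zero.\<close>
        then obtain i where "i \<in> {..<n} - S" "p i \<noteq> i"
          using permutes_superset[of p "{..<n}" S] by auto
        then have "(\<Prod>i\<in>{..<n} - S. ?d i (p i)) = 0"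
          by (intro prod_zero) (simp, metis)
        then show "of_int (sign p) *
          ((\<Prod>i\<in>S. w i * A $$ (i, p i)) * (\<Prod>i\<in>{..<n} - S. ?d i (p i))) = 0"
          by simp
      qed
    qed
    also have "\<dots> = (\<Sum>p | p permutes S. (\<Prod>i\<in>S. w i) * (of_int (sign p) * (\<Prod>i\<in>S. A $$ (i, p i))))"
    proof (intro sum.cong refl)
      fix p assume "p \<in> {p. p permutes S}"
      then have "(\<Prod>i\<in>{..<n} - S. ?d i (p i)) = 1"
        by (intro prod.neutral) (auto simp: permutes_not_in)
      then show "of_int (sign p) * ((\<Prod>i\<in>S. w i * A $$ (i, p i)) * (\<Prod>i\<in>{..<n} - S. ?d i (p i)))
          = (\<Prod>i\<in>S. w i) * (of_int (sign p) * (\<Prod>i\<in>S. A $$ (i, p i)))"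
        by (simp add: prod.distrib mult_ac)
    qed
    also have "\<dots> = (\<Prod>i\<in>S. w i) * Determinant.det (submatrix A S S)"
      by (simp add: det_principal_submatrix[OF A S] sum_distrib_left)
    finally show "(\<Sum>p | p permutes {..<n}. of_int (sign p) *
          ((\<Prod>i\<in>S. w i * A $$ (i, p i)) * (\<Prod>i\<in>{..<n} - S. ?d i (p i))))
        = (\<Prod>i\<in>S. w i) * Determinant.det (submatrix A S S)" .
  qed
  finally show ?thesis .
qed

text \<open>Expanding each product of factors \<open>w i + 1\<close> over the subsets
  \<open>S\<close> of \<open>T\<close> and exchanging the sums collects, for each \<open>S\<close>,
  the mass of all \<open>T\<close> containing it.\<close>

lemma gen_poly_one_plus:
  "gen_poly n \<mu> (\<lambda>i. w i + 1) = (\<Sum>S\<in>Pow {..<n}. (\<Prod>i\<in>S. w i) *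
     complex_of_real (measure_pmf.prob \<mu> {T. T \<subseteq> {..<n} \<and> S \<subseteq> T}))"
proof -
  let ?m = "\<lambda>T. complex_of_real (pmf \<mu> T)"
  have "gen_poly n \<mu> (\<lambda>i. w i + 1) = (\<Sum>T\<in>Pow {..<n}. \<Sum>S\<in>Pow T. ?m T * (\<Prod>i\<in>S. w i))"
    unfolding gen_poly_def
  proof (intro sum.cong refl)
    fix T assume "T \<in> Pow {..<n}"
    then have "finite T" using finite_subset by auto
    then show "?m T * (\<Prod>i\<in>T. w i + 1) = (\<Sum>S\<in>Pow T. ?m T * (\<Prod>i\<in>S. w i))"
      by (simp add: prod_add sum_distrib_left)
  qed
  \<comment> \<open>The inner range depends on \<open>T\<close>; as a restriction of a fixed set it
    fits \<open>sum.swap_restrict\<close>.\<close>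
  also have "\<dots> = (\<Sum>T\<in>Pow {..<n}. \<Sum>S\<in>{S \<in> Pow {..<n}. S \<subseteq> T}. ?m T * (\<Prod>i\<in>S. w i))"
    by (intro sum.cong refl) auto
  also have "\<dots> = (\<Sum>S\<in>Pow {..<n}. \<Sum>T\<in>{T \<in> Pow {..<n}. S \<subseteq> T}. ?m T * (\<Prod>i\<in>S. w i))"
    by (rule sum.swap_restrict) auto
  also have "\<dots> = (\<Sum>S\<in>Pow {..<n}. (\<Prod>i\<in>S. w i) *
      complex_of_real (measure_pmf.prob \<mu> {T. T \<subseteq> {..<n} \<and> S \<subseteq> T}))"
    by (simp add: measure_measure_pmf_finite sum_distrib_left mult.commute)
  finally show ?thesis .
qed

lemma det_one_plus_diag_mult_nonzero:
  fixes A :: "complex mat"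
  assumes A: "A \<in> carrier_mat n n"
    and real: "\<And>v. v \<in> carrier_vec n \<Longrightarrow> Im ((A *\<^sub>v v) \<bullet>c v) = 0"
    and w: "\<And>i. i < n \<Longrightarrow> Im (w i) > 0"
  shows "Determinant.det (mat n n (\<lambda>(i, j). w i * A $$ (i, j) + (if i = j then 1 else 0))) \<noteq> 0"
    (is "Determinant.det ?M \<noteq> 0")
proof
  assume "Determinant.det ?M = 0"
  then obtain v where v: "v \<in> carrier_vec n" "v \<noteq> 0\<^sub>v n" and Mv: "?M *\<^sub>v v = 0\<^sub>v n"
    using det_0_iff_vec_prod_zero[of ?M n] by auto
  define u where "u = A *\<^sub>v v"
  have u: "u \<in> carrier_vec n" using A v by (simp add: u_def)
  have v_eq: "v $ i = - w i * u $ i" if i: "i < n" for i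
  proof -
    have "0 = (?M *\<^sub>v v) $ i" using Mv i by simp
    also have "\<dots> = row ?M i \<bullet> v" using i by (intro index_mult_mat_vec) simp
    also have "\<dots> = (\<Sum>j<n. w i * (A $$ (i, j) * v $ j) + (if i = j then v $ j else 0))"
      unfolding scalar_prod_def using i v by (intro sum.cong) (auto simp: algebra_simps)
    also have "\<dots> = w i * u $ i + v $ i"
      using i v A by (simp add: u_def sum.distrib scalar_prod_def atLeast0LessThan sum_distrib_left)
    finally show ?thesis by (simp add: eq_neg_iff_add_eq_0 add.commute)
  qed
  \<comment> \<open>The conjugation in \<open>\<bullet>c\<close> falls on \<open>v\<close>, so
    \<open>w i\<close> enters conjugated. Its sign change cancels the minus of \<open>v_eq\<close>,
    and the imaginary part becomes a sum of nonnegative terms.\<close>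
  have "u \<bullet>c v = (\<Sum>i<n. - cnj (w i) * (u $ i * cnj (u $ i)))"
    using u v by (auto simp: scalar_prod_def atLeast0LessThan v_eq intro!: sum.cong)
  then have "Im (u \<bullet>c v) = (\<Sum>i<n. Im (w i) * (cmod (u $ i))\<^sup>2)"
    by (simp add: complex_mult_cnj cmod_power2)
  with real[OF v(1)] have "(\<Sum>i<n. Im (w i) * (cmod (u $ i))\<^sup>2) = 0"
    by (simp add: u_def)
  then have "\<forall>i<n. Im (w i) * (cmod (u $ i))\<^sup>2 = 0"
    by (subst (asm) sum_nonneg_eq_0_iff) (use w in \<open>auto simp: less_imp_le\<close>)
  \<comment> \<open>Every \<open>Im (w i)\<close> is strictly positive, so vanishing terms force
    \<open>u = 0\<close>, and then \<open>v_eq\<close> forces \<open>v = 0\<close>.\<close>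
  then have "\<forall>i<n. u $ i = 0" using w by force
  then have "v = 0\<^sub>v n" using v(1) v_eq by (intro eq_vecI) auto
  with v(2) show False by simp
qed

theorem proposition3p5:
  fixes n :: nat and \<mu> :: "nat set pmf" and A :: "complex mat"
  assumes "prob_on_subsets n \<mu>"
    and "determinantal n \<mu> A"
    and "positive_contraction n A"
  shows "strongly_Rayleigh n \<mu>"
  unfolding strongly_Rayleigh_def stable_def
proof (intro allI impI)
  fix z :: "nat \<Rightarrow> complex" assume z: "\<forall>j<n. Im (z j) > 0"
  \<comment> \<open>The shift is by a real number, so \<open>w\<close> has the same positive
    imaginary parts as \<open>z\<close>.\<close>
  define w where "w = (\<lambda>i. z i - 1)"
  have A: "A \<in> carrier_mat n n" using assms(2) by (simp add: determinantal_def)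
  \<comment> \<open>The order on complex numbers compares only numbers with equal imaginary parts,
    so \<open>0 \<le> x\<close> makes \<open>x\<close> real.\<close>
  have real: "Im ((A *\<^sub>v v) \<bullet>c v) = 0" if "v \<in> carrier_vec n" for v
    using assms(3) that
    by (auto simp: positive_contraction_def positive_semidefinite_def less_eq_complex_def)
  have "gen_poly n \<mu> z = gen_poly n \<mu> (\<lambda>i. w i + 1)" by (simp add: w_def)
  also have "\<dots> = (\<Sum>S\<in>Pow {..<n}. (\<Prod>i\<in>S. w i) * Determinant.det (submatrix A S S))"
    unfolding gen_poly_one_plus using assms(2) by (simp add: determinantal_def)
  also have "\<dots> = Determinant.det (mat n n (\<lambda>(i, j). w i * A $$ (i, j) + (if i = j then 1 else 0)))"
    by (rule det_one_plus_diag_mult[OF A, symmetric])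
  also have "\<dots> \<noteq> 0"
    by (rule det_one_plus_diag_mult_nonzero[OF A real]) (use z in \<open>simp_all add: w_def\<close>)
  finally show "gen_poly n \<mu> z \<noteq> 0" .
qed

end
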